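(* Let $n>1$ and $\psi\in(0,1)$ be parameters. Then the optimal deficiency satisfies $\ell(n,\psi)=\Theta\bigl((n/\psi)\log(1/\psi)\bigr)$.
   Context: Let $[n]=\{1,\dots,n\}$ and let $K_n$ be the complete graph on $[n]$. For a graph $G$ with vertex set $[n]$ and $i<j$, a straight path from $i$ to $j$ in $G$ is a path $i=i_1<i_2<\dots<i_m=j$ all of whose consecutive pairs $i_ti_{t+1}$ are edges of $G$. The deficiency $f(G)$ is the number of pairs $i<j$ in $[n]$ with no straight path from $i$ to $j$ in $G$. For $\psi\in(0,1)$, $\mathcal D(G,\psi)$ is the distribution of the random subgraph of $G$ (same vertex set) in which each edge of $G$ is kept independently with probability $\psi$. The optimal deficiency is $\ell(n,\psi)=\mathbb E_{H\sim\mathcal D(K_n,\psi)}[f(H)]$.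
   Formalization: The lower bound fails uniformly (n=2, ψ→0), so the full Θ is stated, for every κ>0, for n ≥ κ(1/ψ)log(1/ψ) with constants depending on κ; the upper bound O((n/ψ)log(1/ψ)) is for all n>1 and ψ in (0,1). *)

theory Defs
  imports "HOL-Probability.Probability" "HOL-Library.Landau_Symbols"
begin

text \<open>All graphs here have vertex set [n] = {1..n}. A graph is given by its set of edges, each a
  two-element set of vertices; n is passed separately where the vertex set matters. Thus a
  subgraph on the same vertex set is a subset of the edge set.\<close>

definition complete_graph :: "nat \<Rightarrow> nat set set" where
  "complete_graph n = {{i, j} | i j. i \<in> {1..n} \<and> j \<in> {1..n} \<and> i \<noteq> j}"

definition straight_path :: "nat set set \<Rightarrow> nat \<Rightarrow> nat \<Rightarrow> nat list \<Rightarrow> bool" where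
  "straight_path G i j p \<longleftrightarrow>
     p \<noteq> [] \<and> hd p = i \<and> last p = j \<and> successively (\<lambda>u v. u < v \<and> {u, v} \<in> G) p"

definition deficiency :: "nat \<Rightarrow> nat set set \<Rightarrow> nat" where
  "deficiency n G =
     card {(i, j). i \<in> {1..n} \<and> j \<in> {1..n} \<and> i < j \<and> \<not> (\<exists>p. straight_path G i j p)}"

text \<open>The edge set must be finite for \<^const>\<open>Pi_pmf\<close> to be the product distribution.\<close>

definition random_subgraph :: "nat set set \<Rightarrow> real \<Rightarrow> nat set set pmf" where
  "random_subgraph G \<psi> =
     map_pmf (\<lambda>keep. {e \<in> G. keep e}) (Pi_pmf G False (\<lambda>_. bernoulli_pmf \<psi>))"

definition optimal_deficiency :: "nat \<Rightarrow> real \<Rightarrow> real" where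
  "optimal_deficiency n \<psi> =
     measure_pmf.expectation (random_subgraph (complete_graph n) \<psi>) (\<lambda>H. real (deficiency n H))"

end

theory Submission
  imports Defs
begin

text \<open>Let \<open>X\<^sub>k\<close> be the number of vertices in \<open>[i, i + k]\<close> that have a straight path from \<open>i\<close>.
  Given \<open>X\<^sub>k = x\<close>, the vertex \<open>i + k + 1\<close> has none with probability \<open>q ^ x\<close>, where \<open>q = 1 - \<psi>\<close>.
  So \<open>X\<close> is a pure birth chain started at 1, and the expected deficiency is the sum of \<open>E (q ^ X\<^sub>k)\<close>
  over \<open>i\<close> and \<open>k\<close>.

  Upper bound: the chain stays at \<open>x\<close> for \<open>1 / (1 - q ^ x)\<close> steps in expectation, so for fixed
  \<open>i\<close> the sum over \<open>k\<close> is at most the Lambert series \<open>\<Sum>x\<ge>1. q ^ x / (1 - q ^ x)\<close>, which is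
  \<open>O(1 / \<psi> * ln (1 / \<psi>))\<close>.

  Lower bound: Bernoulli's inequality \<open>1 - q ^ x \<le> x \<psi>\<close> gives \<open>E X\<^sub>k \<le> (1 + \<psi>) ^ k\<close> and
  \<open>E (q ^ X\<^sub>k) \<ge> 1 - \<psi> (1 + \<psi>) ^ k\<close>, which is bounded away from 0 for small \<open>\<psi>\<close> and
  \<open>k \<le> 1 / (2 \<psi>) * ln (1 / \<psi>)\<close>. For \<open>\<psi> \<ge> 1 / 2\<close> the pairs of consecutive vertices suffice.\<close>

section \<open>Straight paths and stepwise exploration of the reachable vertices\<close>

text \<open>Cutting a path at its last edge turns reachability from \<open>i\<close> into a
  recursion on the endpoint, the shape of the recursion for \<open>reach\<close>.\<close>

lemma ex_straight_path_iff:
  "(\<exists>p. straight_path G i j p) \<longleftrightarrow>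
     j = i \<or> (\<exists>u. u < j \<and> {u, j} \<in> G \<and> (\<exists>p. straight_path G i u p))"
proof
  assume "\<exists>p. straight_path G i j p"
  then obtain p where p: "straight_path G i j p" by blast
  show "j = i \<or> (\<exists>u. u < j \<and> {u, j} \<in> G \<and> (\<exists>p. straight_path G i u p))"
  proof (cases p rule: rev_cases)
    case Nil
    then show ?thesis using p by (simp add: straight_path_def)
  next
    case (snoc ps x)
    then show ?thesis
      using p by (cases "ps = []") (auto simp: straight_path_def successively_append_iff)
  qed
next
  assume "j = i \<or> (\<exists>u. u < j \<and> {u, j} \<in> G \<and> (\<exists>p. straight_path G i u p))"
  then show "\<exists>p. straight_path G i j p"
  proof
    assume "j = i"
    then have "straight_path G i j [i]" by (simp add: straight_path_def)
    then show ?thesis ..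
  next
    assume "\<exists>u. u < j \<and> {u, j} \<in> G \<and> (\<exists>p. straight_path G i u p)"
    then obtain u p where "u < j" "{u, j} \<in> G" "straight_path G i u p" by blast
    then have "straight_path G i j (p @ [j])"
      by (auto simp: straight_path_def successively_append_iff)
    then show ?thesis ..
  qed
qed

lemma straight_path_imp_le: "straight_path G i j p \<Longrightarrow> i \<le> j"
proof (induction j arbitrary: p rule: less_induct)
  case (less j)
  then show ?case using ex_straight_path_iff[of G i j] by (metis less_or_eq_imp_le order.trans)
qed

text \<open>Vertices are explored in increasing order, and step \<open>k\<close> inspects only edges
  into the new vertex \<open>i + Suc k\<close>; these are fresh randomness at that step. The edges
  are given by a predicate because that is what \<open>Pi_pmf\<close> samples.\<close>

primrec reach :: "(nat set \<Rightarrow> bool) \<Rightarrow> nat \<Rightarrow> nat \<Rightarrow> nat set" where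
  "reach keep i 0 = {i}"
| "reach keep i (Suc k) =
     reach keep i k \<union> (if \<exists>u\<in>reach keep i k. keep {u, i + Suc k} then {i + Suc k} else {})"

lemma reach_subset: "reach keep i k \<subseteq> {i..i + k}"
  by (induction k) auto

lemma finite_reach [simp]: "finite (reach keep i k)"
  by (rule finite_subset[OF reach_subset]) simp

lemma card_reach_Suc:
  "card (reach keep i (Suc k)) =
     card (reach keep i k) + (if \<exists>u\<in>reach keep i k. keep {u, i + Suc k} then 1 else 0)"
proof -
  have "i + Suc k \<notin> reach keep i k" using reach_subset[of keep i k] by auto
  then show ?thesis by simp
qed

text \<open>The deterministic side of independence: later edges cannot change what has been
  explored.\<close>

lemma reach_cong:
  assumes "\<And>u v. v \<le> i + k \<Longrightarrow> u < v \<Longrightarrow> keep {u, v} = keep' {u, v}"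
  shows "reach keep i k = reach keep' i k"
  using assms
proof (induction k)
  case (Suc k)
  then have *: "reach keep i k = reach keep' i k" by simp
  have "keep {u, i + Suc k} = keep' {u, i + Suc k}" if "u \<in> reach keep' i k" for u
    using that reach_subset[of keep' i k] by (intro Suc.prems) auto
  then show ?case by (auto simp: *)
qed simp

lemma edge_in_complete_graph:
  "1 \<le> u \<Longrightarrow> u < v \<Longrightarrow> v \<le> n \<Longrightarrow> {u, v} \<in> complete_graph n"
  unfolding complete_graph_def by fastforce

text \<open>The last edge of a path to the new vertex comes from a vertex already explored. The
  bounds on \<open>i\<close> and \<open>k\<close> place every inspected edge in
  \<open>complete_graph n\<close>.\<close>

lemma reach_eq_straight_path:
  assumes "1 \<le> i" "i + k \<le> n"
  shows "reach keep i k = {v. v \<le> i + k \<and> (\<exists>p. straight_path {e \<in> complete_graph n. keep e} i v p)}"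
    (is "_ = {v. _ \<and> ?P v}")
  using assms(2)
proof (induction k)
  case 0
  have "?P i" using ex_straight_path_iff by blast
  then show ?case by (auto dest: straight_path_imp_le)
next
  case (Suc k)
  then have IH: "reach keep i k = {v. v \<le> i + k \<and> ?P v}" by simp
  have "?P (i + Suc k) \<longleftrightarrow> (\<exists>u < i + Suc k. {u, i + Suc k} \<in> complete_graph n \<and> keep {u, i + Suc k} \<and> ?P u)"
    by (subst ex_straight_path_iff) auto
  also have "\<dots> \<longleftrightarrow> (\<exists>u < i + Suc k. keep {u, i + Suc k} \<and> ?P u)"
    using Suc.prems assms(1) by (meson edge_in_complete_graph order.trans straight_path_imp_le)
  also have "\<dots> \<longleftrightarrow> (\<exists>u\<in>reach keep i k. keep {u, i + Suc k})"
    by (auto simp: IH less_Suc_eq_le)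
  finally have "(\<exists>u\<in>reach keep i k. keep {u, i + Suc k}) \<longleftrightarrow> ?P (i + Suc k)" by simp
  then show ?case by (auto simp: IH le_Suc_eq)
qed

lemma no_straight_path_iff:
  assumes "1 \<le> i" "i + Suc k \<le> n"
  shows "\<not> (\<exists>p. straight_path {e \<in> complete_graph n. keep e} i (i + Suc k) p) \<longleftrightarrow>
    \<not> (\<exists>u\<in>reach keep i k. keep {u, i + Suc k})"
proof -
  have "(\<exists>p. straight_path {e \<in> complete_graph n. keep e} i (i + Suc k) p) \<longleftrightarrow>
      i + Suc k \<in> reach keep i (Suc k)"
    using reach_eq_straight_path[OF assms] by simp
  moreover have "i + Suc k \<notin> reach keep i k" using reach_subset[of keep i k] by auto
  ultimately show ?thesis by simp
qed

section \<open>The random edge set as a product of Bernoulli variables\<close>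

lemma finite_complete_graph [simp]: "finite (complete_graph n)"
  by (rule finite_subset[of _ "Pow {1..n}"]) (auto simp: complete_graph_def)

definition keep_pmf :: "nat set set \<Rightarrow> real \<Rightarrow> (nat set \<Rightarrow> bool) pmf" where
  "keep_pmf A \<psi> = Pi_pmf A False (\<lambda>_. bernoulli_pmf \<psi>)"

lemma finite_set_keep_pmf [simp]:
  assumes "finite A"
  shows "finite (set_pmf (keep_pmf A \<psi>))"
proof (rule finite_subset)
  show "set_pmf (keep_pmf A \<psi>) \<subseteq> PiE_dflt A False (\<lambda>_. UNIV)"
    using set_Pi_pmf_subset[OF assms, of False "\<lambda>_. bernoulli_pmf \<psi>"]
    unfolding keep_pmf_def PiE_dflt_def by auto
  show "finite (PiE_dflt A False (\<lambda>_. UNIV :: bool set))"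
    using assms by (intro finite_PiE_dflt) auto
qed

lemma integrable_keep_pmf [simp]:
  "finite A \<Longrightarrow> integrable (measure_pmf (keep_pmf A \<psi>)) (f :: _ \<Rightarrow> real)"
  by (rule integrable_measure_pmf_finite) simp

text \<open>Fubini for two independent blocks of edges. The finite support reduces it to a finite
  sum over the outcomes on \<open>A\<close>.\<close>

lemma expectation_keep_pmf_union:
  fixes F :: "(nat set \<Rightarrow> bool) \<Rightarrow> real"
  assumes "finite A" "finite B" "A \<inter> B = {}"
  shows "measure_pmf.expectation (keep_pmf (A \<union> B) \<psi>) F =
    measure_pmf.expectation (keep_pmf A \<psi>) (\<lambda>f.
      measure_pmf.expectation (keep_pmf B \<psi>) (\<lambda>g. F (\<lambda>e. if e \<in> A then f e else g e)))"
proof -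
  let ?S = "set_pmf (keep_pmf A \<psi>)"
  have "keep_pmf (A \<union> B) \<psi> = keep_pmf A \<psi> \<bind> (\<lambda>f.
      map_pmf (\<lambda>g e. if e \<in> A then f e else g e) (keep_pmf B \<psi>))"
    unfolding keep_pmf_def Pi_pmf_union[OF assms]
    by (simp add: pair_pmf_def map_bind_pmf map_pmf_def bind_assoc_pmf bind_return_pmf)
  then have "measure_pmf.expectation (keep_pmf (A \<union> B) \<psi>) F =
      (\<Sum>f\<in>?S. pmf (keep_pmf A \<psi>) f *
        measure_pmf.expectation (keep_pmf B \<psi>) (\<lambda>g. F (\<lambda>e. if e \<in> A then f e else g e)))"
    by (simp add: pmf_expectation_bind[where A = ?S] assms)
  also have "\<dots> = measure_pmf.expectation (keep_pmf A \<psi>) (\<lambda>f.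
      measure_pmf.expectation (keep_pmf B \<psi>) (\<lambda>g. F (\<lambda>e. if e \<in> A then f e else g e)))"
    by (subst integral_measure_pmf[where A = ?S]) (auto simp: assms)
  finally show ?thesis .
qed

lemma prob_keep_none:
  assumes "finite A" "B \<subseteq> A" "0 \<le> \<psi>" "\<psi> \<le> 1"
  shows "measure_pmf.prob (keep_pmf A \<psi>) {keep. \<forall>e\<in>B. \<not> keep e} = (1 - \<psi>) ^ card B"
proof -
  \<comment> \<open>The event is a cylinder: it prescribes \<open>False\<close> on \<open>B\<close>
    and leaves the other edges free, so its probability factors.\<close>
  have "{keep. \<forall>e\<in>B. \<not> keep e} = Pi A (\<lambda>e. if e \<in> B then {False} else UNIV)"
    using assms(2) by (auto simp: Pi_def)
  then have "measure_pmf.prob (keep_pmf A \<psi>) {keep. \<forall>e\<in>B. \<not> keep e} =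
      (\<Prod>e\<in>A. measure_pmf.prob (bernoulli_pmf \<psi>) (if e \<in> B then {False} else UNIV))"
    by (simp add: keep_pmf_def measure_Pi_pmf_Pi assms(1))
  also have "\<dots> = (\<Prod>e\<in>A. if e \<in> B then 1 - \<psi> else 1)"
    using assms(3,4) by (intro prod.cong) (auto simp: measure_pmf_single)
  also have "\<dots> = (1 - \<psi>) ^ card B"
    using assms(1,2) by (simp add: prod.If_cases Int_absorb1)
  finally show ?thesis .
qed

lemma expectation_keep_some:
  fixes a b :: real
  assumes "finite A" "B \<subseteq> A" "0 \<le> \<psi>" "\<psi> \<le> 1"
  shows "measure_pmf.expectation (keep_pmf A \<psi>) (\<lambda>keep. if \<exists>e\<in>B. keep e then a else b) =
    (1 - \<psi>) ^ card B * b + (1 - (1 - \<psi>) ^ card B) * a"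
proof -
  let ?N = "{keep. \<forall>e\<in>B. \<not> keep e}"
  have "measure_pmf.expectation (keep_pmf A \<psi>) (\<lambda>keep. if \<exists>e\<in>B. keep e then a else b) =
      measure_pmf.expectation (keep_pmf A \<psi>) (\<lambda>keep. a + (b - a) * indicator ?N keep)"
    by (intro Bochner_Integration.integral_cong) (auto simp: indicator_def)
  also have "\<dots> = a + (b - a) * measure_pmf.prob (keep_pmf A \<psi>) ?N"
    using assms(1) by (simp add: Bochner_Integration.integral_add measure_pmf.prob_space)
  finally show ?thesis by (simp add: prob_keep_none[OF assms] algebra_simps)
qed

section \<open>The birth chain and the deficiency as a sum over pairs\<close>

text \<open>Conditioning on the exploration so far: each of the \<open>card (reach keep i k)\<close>
  explored vertices makes one independent attempt to hit the new vertex. An arbitrary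
  \<open>h\<close> lets one computation serve both the count of unreached pairs and the transition
  of the chain.\<close>

lemma expectation_reach_step:
  fixes h :: "nat \<Rightarrow> bool \<Rightarrow> real"
  assumes "1 \<le> i" "i + Suc k \<le> n" "0 \<le> \<psi>" "\<psi> \<le> 1"
  shows "measure_pmf.expectation (keep_pmf (complete_graph n) \<psi>)
      (\<lambda>keep. h (card (reach keep i k)) (\<exists>u\<in>reach keep i k. keep {u, i + Suc k})) =
    measure_pmf.expectation (keep_pmf (complete_graph n) \<psi>)
      (\<lambda>keep. (1 - \<psi>) ^ card (reach keep i k) * h (card (reach keep i k)) False
        + (1 - (1 - \<psi>) ^ card (reach keep i k)) * h (card (reach keep i k)) True)"
proof -
  \<comment> \<open>The edges into \<open>j\<close> are independent of those that determine \<open>reach keep i k\<close>.\<close>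
  define j where "j = i + Suc k"
  define B where "B = (\<lambda>u. {u, j}) ` {i..i + k}"
  define A where "A = complete_graph n - B"
  have "B \<subseteq> complete_graph n"
    using assms(1,2) by (auto simp: B_def j_def intro!: edge_in_complete_graph)
  then have AB: "complete_graph n = A \<union> B" "A \<inter> B = {}" "finite A" "finite B"
    by (auto simp: A_def B_def)
  define glue where "glue f g e = (if e \<in> A then f e else g e)" for f g :: "nat set \<Rightarrow> bool" and e
  \<comment> \<open>On its support \<open>g\<close> takes the default \<open>False\<close> off
    \<open>B\<close>, and no edge inside \<open>{i..i + k}\<close> lies in \<open>B\<close>. So the
    explored set depends on \<open>f\<close> alone.\<close>
  have reach_glue: "reach (glue f g) i k = reach (glue f (\<lambda>_. False)) i k"
    if "g \<in> set_pmf (keep_pmf B \<psi>)" for f g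
  proof (rule reach_cong)
    fix u v :: nat assume uv: "v \<le> i + k" "u < v"
    then have "j \<notin> {u, v}" by (auto simp: j_def)
    then have "{u, v} \<notin> B" unfolding B_def by blast
    moreover have "\<not> g e" if "e \<notin> B" for e
      using \<open>g \<in> _\<close> that set_Pi_pmf_subset[OF \<open>finite B\<close>, of False "\<lambda>_. bernoulli_pmf \<psi>"]
      by (auto simp: keep_pmf_def)
    ultimately show "glue f g {u, v} = glue f (\<lambda>_. False) {u, v}"
      by (simp add: glue_def)
  qed
  have split: "measure_pmf.expectation (keep_pmf (complete_graph n) \<psi>) F =
      measure_pmf.expectation (keep_pmf A \<psi>) (\<lambda>f.
        measure_pmf.expectation (keep_pmf B \<psi>) (\<lambda>g. F (glue f g)))"
    for F :: "(nat set \<Rightarrow> bool) \<Rightarrow> real"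
    unfolding AB(1) glue_def[abs_def] by (rule expectation_keep_pmf_union) (use AB in auto)
  show ?thesis
    unfolding split
  proof (rule Bochner_Integration.integral_cong[OF refl])
    fix f :: "nat set \<Rightarrow> bool"
    define R where "R = reach (glue f (\<lambda>_. False)) i k"
    define S where "S = (\<lambda>u. {u, j}) ` R"
    have R: "R \<subseteq> {i..i + k}" using reach_subset by (simp add: R_def)
    then have S: "S \<subseteq> B" by (auto simp: S_def B_def)
    \<comment> \<open>Distinct explored vertices give distinct edges into \<open>j\<close>, so the
      number of attempts is \<open>card R\<close>.\<close>
    have "inj_on (\<lambda>u. {u, j}) R"
      by (auto simp: inj_on_def doubleton_eq_iff)
    then have card_S: "card S = card R" by (simp add: S_def card_image)
    have "measure_pmf.expectation (keep_pmf B \<psi>) (\<lambda>g.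
        h (card (reach (glue f g) i k)) (\<exists>u\<in>reach (glue f g) i k. glue f g {u, i + Suc k})) =
      measure_pmf.expectation (keep_pmf B \<psi>) (\<lambda>g.
        if \<exists>e\<in>S. g e then h (card R) True else h (card R) False)"
    proof (intro integral_cong_AE AE_pmfI)
      fix g assume g: "g \<in> set_pmf (keep_pmf B \<psi>)"
      have "glue f g e = g e" if "e \<in> S" for e using that S AB(2) by (auto simp: glue_def)
      then have "(\<exists>u\<in>R. glue f g {u, i + Suc k}) \<longleftrightarrow> (\<exists>e\<in>S. g e)"
        by (auto simp: S_def j_def)
      then show "h (card (reach (glue f g) i k)) (\<exists>u\<in>reach (glue f g) i k. glue f g {u, i + Suc k}) =
          (if \<exists>e\<in>S. g e then h (card R) True else h (card R) False)"
        unfolding reach_glue[OF g] R_def[symmetric] by simp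
    qed auto
    also have "\<dots> = (1 - \<psi>) ^ card R * h (card R) False + (1 - (1 - \<psi>) ^ card R) * h (card R) True"
      using expectation_keep_some[OF AB(4) S assms(3,4)] by (simp add: card_S)
    \<comment> \<open>After \<open>split\<close> the right-hand side also has an inner expectation
      over \<open>g\<close>, so the constant is written as one.\<close>
    also have "\<dots> = measure_pmf.expectation (keep_pmf B \<psi>) (\<lambda>g.
        (1 - \<psi>) ^ card R * h (card R) False + (1 - (1 - \<psi>) ^ card R) * h (card R) True)"
      by (simp add: measure_pmf.prob_space)
    also have "\<dots> = measure_pmf.expectation (keep_pmf B \<psi>) (\<lambda>g.
        (1 - \<psi>) ^ card (reach (glue f g) i k) * h (card (reach (glue f g) i k)) False
        + (1 - (1 - \<psi>) ^ card (reach (glue f g) i k)) * h (card (reach (glue f g) i k)) True)"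
      by (intro integral_cong_AE AE_pmfI) (auto simp: reach_glue R_def)
    finally show "measure_pmf.expectation (keep_pmf B \<psi>) (\<lambda>g.
        h (card (reach (glue f g) i k)) (\<exists>u\<in>reach (glue f g) i k. glue f g {u, i + Suc k})) =
      measure_pmf.expectation (keep_pmf B \<psi>) (\<lambda>g.
        (1 - \<psi>) ^ card (reach (glue f g) i k) * h (card (reach (glue f g) i k)) False
        + (1 - (1 - \<psi>) ^ card (reach (glue f g) i k)) * h (card (reach (glue f g) i k)) True)" .
  qed
qed

text \<open>For \<open>1 \<le> i\<close>, \<open>i + Suc k \<le> n\<close> and \<psi> in [0, 1],
  this is the probability that \<open>i + Suc k\<close> has no straight path from \<open>i\<close>,
  expressed through the chain alone.\<close>

definition unreached :: "nat \<Rightarrow> real \<Rightarrow> nat \<Rightarrow> nat \<Rightarrow> real" where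
  "unreached n \<psi> i k =
     measure_pmf.expectation (keep_pmf (complete_graph n) \<psi>) (\<lambda>keep. (1 - \<psi>) ^ card (reach keep i k))"

text \<open>The generator of the birth chain. \<open>W\<close> will be the potential for the upper
  bound and the identity for the lower bound.\<close>

lemma expectation_card_reach_Suc:
  fixes W :: "nat \<Rightarrow> real"
  assumes "1 \<le> i" "i + Suc k \<le> n" "0 \<le> \<psi>" "\<psi> \<le> 1"
  shows "measure_pmf.expectation (keep_pmf (complete_graph n) \<psi>) (\<lambda>keep. W (card (reach keep i (Suc k)))) =
    measure_pmf.expectation (keep_pmf (complete_graph n) \<psi>)
      (\<lambda>keep. W (card (reach keep i k)) + (1 - (1 - \<psi>) ^ card (reach keep i k)) *
         (W (Suc (card (reach keep i k))) - W (card (reach keep i k))))"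
  unfolding card_reach_Suc
  using expectation_reach_step[OF assms, of "\<lambda>x b. W (x + (if b then 1 else 0))"]
  by (simp add: algebra_simps)

lemma optimal_deficiency_eq_sum:
  assumes "0 \<le> \<psi>" "\<psi> \<le> 1"
  shows "optimal_deficiency n \<psi> = (\<Sum>i = 1..n. \<Sum>k < n - i. unreached n \<psi> i k)"
proof -
  let ?E = "measure_pmf.expectation (keep_pmf (complete_graph n) \<psi>) :: (_ \<Rightarrow> real) \<Rightarrow> real"
  let ?new = "\<lambda>keep i k. \<exists>u\<in>reach keep i k. keep {u, i + Suc k}"
  have def: "real (deficiency n {e \<in> complete_graph n. keep e}) =
      (\<Sum>i = 1..n. \<Sum>k < n - i. of_bool (\<not> ?new keep i k))" for keep
  proof -
    \<comment> \<open>A pair (i, j) is coded by i and k with \<open>j = i + Suc k\<close>; then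
      \<open>j \<le> n\<close> becomes \<open>k < n - i\<close>.\<close>
    let ?S = "SIGMA i:{1..n}. {k. k < n - i \<and> \<not> ?new keep i k}"
    have "{(i, j). i \<in> {1..n} \<and> j \<in> {1..n} \<and> i < j \<and>
        \<not> (\<exists>p. straight_path {e \<in> complete_graph n. keep e} i j p)} =
      (\<lambda>(i, k). (i, i + Suc k)) ` ?S" (is "?L = ?R")
    proof (intro equalityI subsetI)
      fix x assume "x \<in> ?L"
      then obtain i j where x: "x = (i, j)" "1 \<le> i" "j \<le> n" "i < j"
        "\<not> (\<exists>p. straight_path {e \<in> complete_graph n. keep e} i j p)" by auto
      obtain k where k: "j = i + Suc k" using less_imp_Suc_add[OF \<open>i < j\<close>] by auto
      then have "(i, k) \<in> ?S" using x no_straight_path_iff[of i k n keep] by simp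
      then show "x \<in> ?R" using x(1) k by (intro image_eqI[of _ _ "(i, k)"]) auto
    next
      fix x assume "x \<in> ?R"
      then obtain i k where "x = (i, i + Suc k)" "1 \<le> i" "i + Suc k \<le> n" "\<not> ?new keep i k"
        by auto
      then show "x \<in> ?L" using no_straight_path_iff[of i k n keep] by simp
    qed
    moreover have "inj_on (\<lambda>(i, k). (i, i + Suc k)) ?S" by (auto simp: inj_on_def)
    ultimately have "deficiency n {e \<in> complete_graph n. keep e} = card ?S"
      by (simp add: deficiency_def card_image)
    also have "\<dots> = (\<Sum>i = 1..n. card {k. k < n - i \<and> \<not> ?new keep i k})"
      by (subst card_SigmaI) auto
    finally show ?thesis
      by (simp add: of_bool_def sum.If_cases Int_def lessThan_def)
  qed
  have "optimal_deficiency n \<psi> = ?E (\<lambda>keep. real (deficiency n {e \<in> complete_graph n. keep e}))"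
    by (simp add: optimal_deficiency_def random_subgraph_def keep_pmf_def)
  also have "\<dots> = (\<Sum>i = 1..n. \<Sum>k < n - i. ?E (\<lambda>keep. of_bool (\<not> ?new keep i k)))"
    unfolding def by (simp only: Bochner_Integration.integral_sum integrable_keep_pmf finite_complete_graph)
  also have "\<dots> = (\<Sum>i = 1..n. \<Sum>k < n - i. unreached n \<psi> i k)"
  proof (intro sum.cong refl)
    fix i k assume "i \<in> {1..n}" "k \<in> {..<n - i}"
    then have "1 \<le> i" "i + Suc k \<le> n" by auto
    from expectation_reach_step[OF this assms, of "\<lambda>_ b. of_bool (\<not> b)"]
    show "?E (\<lambda>keep. of_bool (\<not> ?new keep i k)) = unreached n \<psi> i k"
      by (simp add: unreached_def)
  qed
  finally show ?thesis .
qed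

section \<open>Estimates for partial Lambert sums and for the growth of the chain\<close>

text \<open>The increment at \<open>x\<close>, times the probability \<open>1 - (1 - \<psi>) ^ x\<close> that the chain leaves
  \<open>x\<close>, is exactly \<open>(1 - \<psi>) ^ x\<close>.\<close>

definition potential :: "real \<Rightarrow> nat \<Rightarrow> real" where
  "potential \<psi> x = (\<Sum>y = 1..<x. (1 - \<psi>) ^ y / (1 - (1 - \<psi>) ^ y))"

lemma sum_power_le:
  fixes q :: real
  assumes "0 \<le> q" "q < 1"
  shows "(\<Sum>y = 1..<x. q ^ y) \<le> q / (1 - q)"
proof -
  have "(\<Sum>y = 1..<x. q ^ y) = (\<Sum>y<x - 1. q * q ^ y)"
    by (rule sum.reindex_bij_witness[of _ Suc "\<lambda>y. y - 1"]) (auto simp: Suc_diff_Suc simp flip: power_Suc)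
  also have "\<dots> = q * ((1 - q ^ (x - 1)) / (1 - q))"
    using assms by (simp add: sum_gp_strict flip: sum_distrib_left)
  also have "\<dots> \<le> q * (1 / (1 - q))"
    using assms by (intro mult_left_mono divide_right_mono) auto
  finally show ?thesis by simp
qed

lemma one_minus_le_ln_inverse: "0 < \<psi> \<Longrightarrow> 1 - \<psi> \<le> ln (1 / \<psi>)" for \<psi> :: real
  using ln_le_minus_one[of \<psi>] by (simp add: ln_div)

lemma ln_inverse_le: "0 < \<psi> \<Longrightarrow> ln (1 / \<psi>) \<le> (1 - \<psi>) / \<psi>" for \<psi> :: real
  using ln_le_minus_one[of "1 / \<psi>"] by (simp add: diff_divide_distrib)

lemma harm_le_ln: "0 < n \<Longrightarrow> harm n \<le> 1 + ln (real n)"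
  using euler_mascheroni_sequence_decreasing[of 1 n] by (simp add: harm_expand)

text \<open>The target vanishes as \<psi> tends to 1, so the bound must keep a factor
  \<open>1 - \<psi>\<close>. All denominators are at least \<psi>, which leaves a geometric series,
  and \<open>1 - \<psi> \<le> ln (1 / \<psi>)\<close> finishes.\<close>

lemma potential_le_large:
  assumes "1 / 2 \<le> \<psi>" "\<psi> < 1"
  shows "potential \<psi> x \<le> 2 * (1 / \<psi> * ln (1 / \<psi>))"
proof -
  have "potential \<psi> x \<le> (\<Sum>y = 1..<x. (1 - \<psi>) ^ y / \<psi>)"
    unfolding potential_def
  proof (intro sum_mono divide_left_mono)
    fix y assume "y \<in> {1..<x}"
    then have "(1 - \<psi>) ^ y \<le> (1 - \<psi>) ^ 1" using assms by (intro power_decreasing) auto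
    then show "\<psi> \<le> 1 - (1 - \<psi>) ^ y" by simp
    then show "0 < (1 - (1 - \<psi>) ^ y) * \<psi>" using assms by simp
  qed (use assms in auto)
  also have "\<dots> = (\<Sum>y = 1..<x. (1 - \<psi>) ^ y) / \<psi>" by (simp add: sum_divide_distrib)
  also have "\<dots> \<le> ((1 - \<psi>) / (1 - (1 - \<psi>))) / \<psi>"
    using assms by (intro divide_right_mono sum_power_le) auto
  also have "\<dots> = 1 / \<psi> * ((1 - \<psi>) * (1 / \<psi>))" by simp
  also have "\<dots> \<le> 1 / \<psi> * (ln (1 / \<psi>) * 2)"
    using assms one_minus_le_ln_inverse[of \<psi>]
    by (intro mult_left_mono mult_mono) (auto simp: field_simps)
  finally show ?thesis by (simp add: mult.commute)
qed

text \<open>Bernoulli for \<open>1 + \<psi>\<close> together with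
  \<open>(1 - \<psi>) * (1 + \<psi>) \<le> 1\<close> gives
  \<open>(1 - \<psi>) ^ y * (1 + y * \<psi>) \<le> 1\<close>. The first bound serves y up to about
  1/\<psi>, the second the tail.\<close>

lemma power_div_one_minus_power_le:
  fixes \<psi> :: real
  assumes "0 < \<psi>" "\<psi> < 1" "0 < y"
  shows "(1 - \<psi>) ^ y / (1 - (1 - \<psi>) ^ y) \<le> 1 / (real y * \<psi>)"
    and "1 \<le> real y * \<psi> \<Longrightarrow> (1 - \<psi>) ^ y / (1 - (1 - \<psi>) ^ y) \<le> 2 * (1 - \<psi>) ^ y"
proof -
  let ?t = "(1 - \<psi>) ^ y" and ?z = "real y * \<psi>"
  have z: "0 < ?z" using assms by simp
  have t: "0 < ?t" "?t < 1" using assms by (auto simp: power_less_one_iff)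
  have "1 + ?z \<le> (1 + \<psi>) ^ y" using Bernoulli_inequality[of \<psi> y] assms by simp
  then have "?t * (1 + ?z) \<le> ?t * (1 + \<psi>) ^ y" using t by (intro mult_left_mono) auto
  also have "\<dots> = ((1 - \<psi>) * (1 + \<psi>)) ^ y" by (simp only: power_mult_distrib)
  also have "\<dots> \<le> 1" using assms by (intro power_le_one) (auto simp: algebra_simps mult_le_one)
  finally have *: "?t * ?z \<le> 1 - ?t" by (simp add: algebra_simps)
  then show "?t / (1 - ?t) \<le> 1 / ?z"
    using t z by (simp add: pos_divide_le_eq pos_le_divide_eq mult.commute)
  assume "1 \<le> ?z"
  then have "?t * 1 \<le> ?t * ?z" using t by (intro mult_left_mono) auto
  with * have "2 * ?t \<le> 1" by linarith
  then have "1 / (1 - ?t) \<le> 2" using t by (simp add: pos_divide_le_eq)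
  then have "?t * (1 / (1 - ?t)) \<le> ?t * 2" using t by (intro mult_left_mono) auto
  then show "?t / (1 - ?t) \<le> 2 * ?t" by simp
qed

lemma potential_le_small:
  assumes "0 < \<psi>" "\<psi> \<le> 1 / 2"
  shows "potential \<psi> x \<le> 9 * (1 / \<psi> * ln (1 / \<psi>))"
proof -
  \<comment> \<open>The cutoff between the two regimes: the harmonic part up to \<open>M\<close>
    contributes the logarithm, the geometric part only O(1/\<psi>).\<close>
  define M where "M = nat \<lceil>1 / \<psi>\<rceil>"
  have M: "1 / \<psi> \<le> real M" "real M \<le> 1 / \<psi> + 1" "0 < M"
    using assms by (auto simp: M_def)
  \<comment> \<open>The geometric term is added for every \<open>y\<close>, so that its sum needs no
    case split.\<close>
  have "potential \<psi> x \<le> (\<Sum>y = 1..<x. (if y \<le> M then 1 / (real y * \<psi>) else 0) + 2 * (1 - \<psi>) ^ y)"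
    unfolding potential_def
  proof (intro sum_mono)
    fix y assume "y \<in> {1..<x}"
    then have y: "0 < y" by simp
    show "(1 - \<psi>) ^ y / (1 - (1 - \<psi>) ^ y) \<le> (if y \<le> M then 1 / (real y * \<psi>) else 0) + 2 * (1 - \<psi>) ^ y"
    proof (cases "y \<le> M")
      case True
      have "(1 - \<psi>) ^ y / (1 - (1 - \<psi>) ^ y) \<le> 1 / (real y * \<psi>) + 2 * (1 - \<psi>) ^ y"
        using assms y by (intro add_increasing2 power_div_one_minus_power_le) auto
      then show ?thesis using True by simp
    next
      case False
      then have "1 / \<psi> \<le> real y" using M(1) by simp
      then have "1 \<le> real y * \<psi>" using assms by (simp add: field_simps)
      then show ?thesis using power_div_one_minus_power_le(2)[of \<psi> y] y assms False by simp
    qed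
  qed
  also have "\<dots> = (\<Sum>y = 1..<x. if y \<le> M then 1 / (real y * \<psi>) else 0) + 2 * (\<Sum>y = 1..<x. (1 - \<psi>) ^ y)"
    by (simp add: sum.distrib sum_distrib_left)
  also have "(\<Sum>y = 1..<x. if y \<le> M then 1 / (real y * \<psi>) else 0) =
      (\<Sum>y\<in>{1..<x} \<inter> {1..M}. 1 / (real y * \<psi>))"
    by (rule sum.mono_neutral_cong_right) auto
  also have "\<dots> \<le> (\<Sum>y = 1..M. 1 / (real y * \<psi>))"
    using assms by (intro sum_mono2) auto
  also have "\<dots> = harm M / \<psi>"
    by (simp add: harm_def sum_distrib_right divide_inverse)
  also have "harm M / \<psi> \<le> (2 + ln (1 / \<psi>)) / \<psi>"
  proof (rule divide_right_mono)
    have "real M \<le> 2 * (1 / \<psi>)" using M(2) assms by (simp add: field_simps)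
    then have "ln (real M) \<le> ln (2 * (1 / \<psi>))" using M(3) assms by (intro ln_mono) auto
    also have "\<dots> = ln 2 + ln (1 / \<psi>)" using assms by (intro ln_mult_pos) auto
    finally show "harm M \<le> 2 + ln (1 / \<psi>)"
      using harm_le_ln[OF M(3)] ln_2_less_1 by simp
  qed (use assms in simp)
  also have "2 * (\<Sum>y = 1..<x. (1 - \<psi>) ^ y) \<le> 2 * ((1 - \<psi>) / (1 - (1 - \<psi>)))"
    using assms by (intro mult_left_mono sum_power_le) auto
  also have "\<dots> \<le> 2 / \<psi>" using assms by (simp add: field_simps)
  also have "(2 + ln (1 / \<psi>)) / \<psi> + 2 / \<psi> = (4 + ln (1 / \<psi>)) / \<psi>"
    by (simp flip: add_divide_distrib)
  also have "\<dots> \<le> (9 * ln (1 / \<psi>)) / \<psi>"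
  proof (rule divide_right_mono)
    \<comment> \<open>Here \<open>ln (1 / \<psi>) \<ge> 1 - \<psi> \<ge> 1 / 2\<close>, so 4 is at
      most eight logarithms.\<close>
    show "4 + ln (1 / \<psi>) \<le> 9 * ln (1 / \<psi>)"
      using one_minus_le_ln_inverse[of \<psi>] assms by linarith
  qed (use assms in simp)
  finally show ?thesis by simp
qed

lemma potential_le:
  assumes "0 < \<psi>" "\<psi> < 1"
  shows "potential \<psi> x \<le> 9 * (1 / \<psi> * ln (1 / \<psi>))"
proof (cases "\<psi> \<le> 1 / 2")
  case True
  then show ?thesis using potential_le_small assms by blast
next
  case False
  have "0 \<le> 1 / \<psi> * ln (1 / \<psi>)" using assms by (intro mult_nonneg_nonneg) auto
  then show ?thesis using potential_le_large[of \<psi> x] False assms by linarith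
qed

text \<open>By \<open>1 + \<psi> \<le> exp \<psi>\<close>, the power is at most
  \<open>exp (k * \<psi>)\<close>. Halving the range of \<open>k\<close> caps this at
  \<open>1 / sqrt \<psi>\<close>, so that a factor \<open>sqrt \<psi>\<close> survives.\<close>

lemma power_one_plus_le:
  assumes "0 < \<psi>" "\<psi> < 1" "real k \<le> 1 / \<psi> * ln (1 / \<psi>) / 2"
  shows "\<psi> * (1 + \<psi>) ^ k \<le> sqrt \<psi>"
proof -
  have "(1 + \<psi>) ^ k \<le> exp \<psi> ^ k" using assms by (intro power_mono exp_ge_add_one_self) auto
  also have "\<dots> = exp (real k * \<psi>)" by (simp add: exp_of_nat_mult)
  also have "real k * \<psi> \<le> ln (1 / \<psi>) / 2" using assms by (simp add: field_simps)
  also have "ln (1 / \<psi>) / 2 = ln (1 / sqrt \<psi>)" using assms by (simp add: ln_div ln_sqrt)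
  also have "exp \<dots> = 1 / sqrt \<psi>" using assms by simp
  finally have "(1 + \<psi>) ^ k \<le> 1 / sqrt \<psi>" by simp
  then have "\<psi> * (1 + \<psi>) ^ k \<le> \<psi> * (1 / sqrt \<psi>)" using assms by (intro mult_left_mono) auto
  also have "\<dots> = sqrt \<psi>" using assms by (simp add: real_div_sqrt)
  finally show ?thesis .
qed

section \<open>Upper bound\<close>

lemma potential_Suc:
  "1 \<le> x \<Longrightarrow> potential \<psi> (Suc x) = potential \<psi> x + (1 - \<psi>) ^ x / (1 - (1 - \<psi>) ^ x)"
  by (simp add: potential_def)

lemma card_reach_pos: "0 < card (reach keep i k)"
proof -
  have "i \<in> reach keep i k" by (induction k) auto
  then show ?thesis by (auto simp: card_gt_0_iff)
qed

text \<open>Dynkin's formula: the expected growth of the potential in step \<open>N\<close> is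
  exactly \<open>unreached n \<psi> i N\<close>, and the sum telescopes. The chain starts at 1,
  where the potential is an empty sum.\<close>

lemma sum_unreached_eq_potential:
  assumes "1 \<le> i" "i + N \<le> n" "0 < \<psi>" "\<psi> < 1"
  shows "(\<Sum>k<N. unreached n \<psi> i k) =
    measure_pmf.expectation (keep_pmf (complete_graph n) \<psi>) (\<lambda>keep. potential \<psi> (card (reach keep i N)))"
  using assms(2)
proof (induction N)
  case 0
  then show ?case by (simp add: potential_def)
next
  case (Suc N)
  let ?E = "measure_pmf.expectation (keep_pmf (complete_graph n) \<psi>) :: (_ \<Rightarrow> real) \<Rightarrow> real"
  have "?E (\<lambda>keep. potential \<psi> (card (reach keep i (Suc N)))) =
      ?E (\<lambda>keep. potential \<psi> (card (reach keep i N)) + (1 - (1 - \<psi>) ^ card (reach keep i N)) *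
         (potential \<psi> (Suc (card (reach keep i N))) - potential \<psi> (card (reach keep i N))))"
    using assms Suc.prems by (intro expectation_card_reach_Suc) auto
  also have "\<dots> = ?E (\<lambda>keep. potential \<psi> (card (reach keep i N)) + (1 - \<psi>) ^ card (reach keep i N))"
  proof (intro Bochner_Integration.integral_cong refl)
    fix keep
    let ?x = "card (reach keep i N)"
    have x: "0 < ?x" by (rule card_reach_pos)
    \<comment> \<open>A nonempty explored set gives a positive probability of leaving the state, so
      the denominator in the increment cancels.\<close>
    then have "(1 - \<psi>) ^ ?x < 1" using assms by (subst power_less_one_iff) auto
    then show "potential \<psi> ?x + (1 - (1 - \<psi>) ^ ?x) * (potential \<psi> (Suc ?x) - potential \<psi> ?x) =
        potential \<psi> ?x + (1 - \<psi>) ^ ?x"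
      using x by (simp add: potential_Suc)
  qed
  also have "\<dots> = ?E (\<lambda>keep. potential \<psi> (card (reach keep i N))) + unreached n \<psi> i N"
    by (simp add: unreached_def)
  finally show ?case using Suc by simp
qed

lemma unreached_nonneg: "\<psi> \<le> 1 \<Longrightarrow> 0 \<le> unreached n \<psi> i k"
  by (simp add: unreached_def)

lemma optimal_deficiency_le:
  assumes "0 < \<psi>" "\<psi> < 1"
  shows "optimal_deficiency n \<psi> \<le> 9 * (real n / \<psi> * ln (1 / \<psi>))"
proof -
  have "optimal_deficiency n \<psi> = (\<Sum>i = 1..n. \<Sum>k < n - i. unreached n \<psi> i k)"
    using assms by (intro optimal_deficiency_eq_sum) auto
  also have "\<dots> \<le> (\<Sum>i = 1..n. 9 * (1 / \<psi> * ln (1 / \<psi>)))"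
  proof (rule sum_mono)
    fix i assume i: "i \<in> {1..n}"
    have "(\<Sum>k < n - i. unreached n \<psi> i k) = measure_pmf.expectation (keep_pmf (complete_graph n) \<psi>)
        (\<lambda>keep. potential \<psi> (card (reach keep i (n - i))))"
      using i assms by (intro sum_unreached_eq_potential) auto
    also have "\<dots> \<le> measure_pmf.expectation (keep_pmf (complete_graph n) \<psi>)
        (\<lambda>keep. 9 * (1 / \<psi> * ln (1 / \<psi>)))"
      by (intro integral_mono potential_le assms) simp_all
    finally show "(\<Sum>k < n - i. unreached n \<psi> i k) \<le> 9 * (1 / \<psi> * ln (1 / \<psi>))"
      by (simp add: measure_pmf.prob_space)
  qed
  finally show ?thesis by (simp add: algebra_simps)
qed

section \<open>Lower bound\<close>

lemma one_minus_mult_le_power: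
  fixes \<psi> :: real
  assumes "\<psi> \<le> 1"
  shows "1 - real x * \<psi> \<le> (1 - \<psi>) ^ x"
  using Bernoulli_inequality[of "- \<psi>" x] assms by simp

lemma expectation_card_reach_le:
  assumes "1 \<le> i" "i + k \<le> n" "0 \<le> \<psi>" "\<psi> \<le> 1"
  shows "measure_pmf.expectation (keep_pmf (complete_graph n) \<psi>) (\<lambda>keep. real (card (reach keep i k)))
    \<le> (1 + \<psi>) ^ k"
  using assms(2)
proof (induction k)
  case 0
  then show ?case by (simp add: measure_pmf.prob_space)
next
  case (Suc k)
  let ?E = "measure_pmf.expectation (keep_pmf (complete_graph n) \<psi>) :: (_ \<Rightarrow> real) \<Rightarrow> real"
  have "?E (\<lambda>keep. real (card (reach keep i (Suc k)))) =
      ?E (\<lambda>keep. real (card (reach keep i k)) + (1 - (1 - \<psi>) ^ card (reach keep i k)) *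
         (real (Suc (card (reach keep i k))) - real (card (reach keep i k))))"
    using assms Suc.prems by (intro expectation_card_reach_Suc) auto
  also have "\<dots> \<le> ?E (\<lambda>keep. (1 + \<psi>) * real (card (reach keep i k)))"
  proof (intro integral_mono)
    fix keep
    show "real (card (reach keep i k)) + (1 - (1 - \<psi>) ^ card (reach keep i k)) *
         (real (Suc (card (reach keep i k))) - real (card (reach keep i k)))
      \<le> (1 + \<psi>) * real (card (reach keep i k))"
      using one_minus_mult_le_power[OF assms(4), of "card (reach keep i k)"]
      by (simp add: algebra_simps)
  qed simp_all
  also have "\<dots> = (1 + \<psi>) * ?E (\<lambda>keep. real (card (reach keep i k)))" by simp
  also have "\<dots> \<le> (1 + \<psi>) * (1 + \<psi>) ^ k"
    using Suc assms(3) by (intro mult_left_mono) auto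
  finally show ?case by simp
qed

lemma unreached_ge:
  assumes "1 \<le> i" "i + k \<le> n" "0 \<le> \<psi>" "\<psi> \<le> 1"
  shows "1 - \<psi> * (1 + \<psi>) ^ k \<le> unreached n \<psi> i k"
proof -
  let ?E = "measure_pmf.expectation (keep_pmf (complete_graph n) \<psi>) :: (_ \<Rightarrow> real) \<Rightarrow> real"
  have "\<psi> * ?E (\<lambda>keep. real (card (reach keep i k))) \<le> \<psi> * (1 + \<psi>) ^ k"
    using assms by (intro mult_left_mono expectation_card_reach_le) auto
  then have "1 - \<psi> * (1 + \<psi>) ^ k \<le> ?E (\<lambda>keep. 1 - real (card (reach keep i k)) * \<psi>)"
    by (simp add: measure_pmf.prob_space mult.commute)
  also have "\<dots> \<le> unreached n \<psi> i k"
    unfolding unreached_def by (intro integral_mono one_minus_mult_le_power assms) simp_all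
  finally show ?thesis .
qed

text \<open>A rectangle of pairs inside the triangle \<open>i + k < n\<close>: the first
  \<open>n - n div 2\<close> starting points, at least half of all, each leave room for
  \<open>m\<close> gaps.\<close>

lemma optimal_deficiency_ge_block:
  assumes "0 \<le> \<psi>" "\<psi> \<le> 1" "m \<le> n div 2" "0 \<le> c"
    and "\<And>k. k < m \<Longrightarrow> \<psi> * (1 + \<psi>) ^ k \<le> 1 - c"
  shows "real n / 2 * (real m * c) \<le> optimal_deficiency n \<psi>"
proof -
  have "real n / 2 \<le> real (n - n div 2)" by linarith
  then have "real n / 2 * (real m * c) \<le> real (n - n div 2) * (real m * c)"
    using assms(4) by (intro mult_right_mono) auto
  also have "\<dots> = (\<Sum>i = 1..n - n div 2. \<Sum>k<m. c)" by simp
  also have "\<dots> \<le> (\<Sum>i = 1..n - n div 2. \<Sum>k<m. unreached n \<psi> i k)"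
  proof (intro sum_mono)
    fix i k assume "i \<in> {1..n - n div 2}" "k \<in> {..<m}"
    then show "c \<le> unreached n \<psi> i k"
      using assms(5)[of k] unreached_ge[of i k n \<psi>] assms(1-3) by force
  qed
  also have "\<dots> \<le> (\<Sum>i = 1..n - n div 2. \<Sum>k<n - i. unreached n \<psi> i k)"
    using assms(2,3) by (intro sum_mono sum_mono2 unreached_nonneg) auto
  also have "\<dots> \<le> (\<Sum>i = 1..n. \<Sum>k<n - i. unreached n \<psi> i k)"
    using assms(2) by (intro sum_mono2 sum_nonneg unreached_nonneg) auto
  also have "\<dots> = optimal_deficiency n \<psi>"
    using optimal_deficiency_eq_sum assms(1,2) by simp
  finally show ?thesis .
qed

lemma optimal_deficiency_ge_large:
  assumes "1 < n" "1 / 2 \<le> \<psi>" "\<psi> < 1"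
  shows "real n / \<psi> * ln (1 / \<psi>) / 8 \<le> optimal_deficiency n \<psi>"
proof -
  have "1 / \<psi> * ln (1 / \<psi>) \<le> 2 * (2 * (1 - \<psi>))"
  proof (rule mult_mono)
    show "1 / \<psi> \<le> 2" using assms by (simp add: field_simps)
    have "(1 - \<psi>) / \<psi> \<le> (1 - \<psi>) / (1 / 2)" using assms by (intro divide_left_mono) auto
    then show "ln (1 / \<psi>) \<le> 2 * (1 - \<psi>)" using ln_inverse_le[of \<psi>] assms by simp
  qed (use assms in auto)
  then have "real n / 8 * (1 / \<psi> * ln (1 / \<psi>)) \<le> real n / 8 * (2 * (2 * (1 - \<psi>)))"
    by (intro mult_left_mono) auto
  \<comment> \<open>Only consecutive vertices are counted: \<open>m = 1\<close> and
    \<open>c = 1 - \<psi>\<close>, for which the condition at \<open>k = 0\<close> is an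
    equality.\<close>
  also have "\<dots> = real n / 2 * (real 1 * (1 - \<psi>))" by simp
  also have "\<dots> \<le> optimal_deficiency n \<psi>"
    using assms by (intro optimal_deficiency_ge_block) auto
  finally show ?thesis by (simp add: mult.commute)
qed

lemma optimal_deficiency_ge_small:
  assumes "1 < n" "0 < \<psi>" "\<psi> \<le> 1 / 2" "\<kappa> * (1 / \<psi> * ln (1 / \<psi>)) \<le> real n"
  shows "min (\<kappa> / 3) (1 / 2) / 8 * (real n / \<psi> * ln (1 / \<psi>)) \<le> optimal_deficiency n \<psi>"
proof -
  define L where "L = 1 / \<psi> * ln (1 / \<psi>)"
  have L: "0 \<le> L" using assms unfolding L_def by (intro mult_nonneg_nonneg) auto
  \<comment> \<open>\<open>Suc (nat \<lfloor>L / 2\<rfloor>)\<close> counts the \<open>k\<close>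
    with \<open>k \<le> L / 2\<close>, zero included, so it is at least \<open>L / 2\<close>; the
    other entry is the room in the block.\<close>
  define m where "m = min (n div 2) (Suc (nat \<lfloor>L / 2\<rfloor>))"
  have "real n / 3 \<le> real (n div 2)"
  proof -
    \<comment> \<open>Equality holds at \<open>n = 3\<close>; hence the factor \<kappa> / 3 in the
      constant.\<close>
    have "n \<le> 3 * (n div 2)" using assms(1) by presburger
    then show ?thesis by linarith
  qed
  moreover have "min (\<kappa> / 3) (1 / 2) * L \<le> \<kappa> / 3 * L" "min (\<kappa> / 3) (1 / 2) * L \<le> 1 / 2 * L"
    by (rule mult_right_mono[OF min.cobounded1 L] mult_right_mono[OF min.cobounded2 L])+
  moreover have "L / 2 \<le> real (Suc (nat \<lfloor>L / 2\<rfloor>))" by linarith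
  ultimately have m: "min (\<kappa> / 3) (1 / 2) * L \<le> real m"
    using assms(4)[folded L_def] unfolding m_def of_nat_min by linarith
  \<comment> \<open>Since 1/2 < 9/16; this gives \<open>c = 1 / 4\<close> for the block.\<close>
  have "sqrt \<psi> \<le> 3 / 4" using assms by (intro real_le_lsqrt) (auto simp: power2_eq_square)
  have "\<psi> * (1 + \<psi>) ^ k \<le> 1 - 1 / 4" if "k < m" for k
  proof -
    have "real k \<le> L / 2" using that L by (simp add: m_def) linarith
    then have "\<psi> * (1 + \<psi>) ^ k \<le> sqrt \<psi>" using assms by (intro power_one_plus_le) (auto simp: L_def)
    with \<open>sqrt \<psi> \<le> 3 / 4\<close> show ?thesis by simp
  qed
  then have block: "real n / 2 * (real m * (1 / 4)) \<le> optimal_deficiency n \<psi>"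
    using assms by (intro optimal_deficiency_ge_block) (auto simp: m_def)
  have "min (\<kappa> / 3) (1 / 2) / 8 * (real n / \<psi> * ln (1 / \<psi>)) =
      real n / 8 * (min (\<kappa> / 3) (1 / 2) * L)"
    by (simp add: L_def mult_ac)
  also have "\<dots> \<le> real n / 8 * real m"
    using m by (intro mult_left_mono) auto
  finally show ?thesis using block by simp
qed

lemma optimal_deficiency_ge:
  assumes "1 < n" "0 < \<psi>" "\<psi> < 1" "\<kappa> * (1 / \<psi> * ln (1 / \<psi>)) \<le> real n"
  shows "min (\<kappa> / 3) (1 / 2) / 8 * (real n / \<psi> * ln (1 / \<psi>)) \<le> optimal_deficiency n \<psi>"
proof (cases "\<psi> \<le> 1 / 2")
  case True
  then show ?thesis using optimal_deficiency_ge_small assms by blast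
next
  case False
  have "0 \<le> real n / \<psi> * ln (1 / \<psi>)" using assms by (intro mult_nonneg_nonneg) auto
  then have "min (\<kappa> / 3) (1 / 2) / 8 * (real n / \<psi> * ln (1 / \<psi>)) \<le> 1 / 8 * (real n / \<psi> * ln (1 / \<psi>))"
    by (intro mult_right_mono) auto
  also have "\<dots> \<le> optimal_deficiency n \<psi>"
    using optimal_deficiency_ge_large[of n \<psi>] False assms by simp
  finally show ?thesis .
qed

section \<open>Asymptotic form\<close>

text \<open>There are only n(n-1)/2 pairs, so for fixed \<open>n\<close> the lower bound fails as
  \<psi> tends to 0. Theta is therefore claimed where \<open>n\<close> is at least a fixed multiple
  of \<open>1 / \<psi> * ln (1 / \<psi>)\<close>, the upper bound everywhere. A
  \<open>principal\<close> filter makes the constants uniform over the region; the lower one depends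
  on \<kappa>.\<close>

theorem theorem3p9:
  "(\<lambda>(n, \<psi>). optimal_deficiency n \<psi>)
      \<in> O[principal {(n :: nat, \<psi> :: real). 1 < n \<and> 0 < \<psi> \<and> \<psi> < 1}](
          \<lambda>(n, \<psi>). real n / \<psi> * ln (1 / \<psi>))
   \<and> (\<forall>\<kappa> > 0. (\<lambda>(n, \<psi>). optimal_deficiency n \<psi>)
      \<in> \<Theta>[principal {(n :: nat, \<psi> :: real). 1 < n \<and> 0 < \<psi> \<and> \<psi> < 1
                           \<and> \<kappa> * (1 / \<psi> * ln (1 / \<psi>)) \<le> real n}](
          \<lambda>(n, \<psi>). real n / \<psi> * ln (1 / \<psi>)))"
proof (intro conjI allI impI)
  have nonneg: "0 \<le> optimal_deficiency n \<psi>" for n \<psi>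
    by (simp add: optimal_deficiency_def)
  have nonneg': "0 \<le> real n / \<psi> * ln (1 / \<psi>)" if "0 < \<psi>" "\<psi> < 1" for n \<psi>
    using that by (intro mult_nonneg_nonneg) auto
  show "(\<lambda>(n, \<psi>). optimal_deficiency n \<psi>)
      \<in> O[principal {(n :: nat, \<psi> :: real). 1 < n \<and> 0 < \<psi> \<and> \<psi> < 1}](
          \<lambda>(n, \<psi>). real n / \<psi> * ln (1 / \<psi>))"
    by (rule bigoI[of _ 9], unfold eventually_principal)
       (use optimal_deficiency_le nonneg nonneg' in \<open>fastforce simp only: real_norm_def abs_of_nonneg
          mem_Collect_eq split_beta\<close>)
  fix \<kappa> :: real assume "\<kappa> > 0"
  then show "(\<lambda>(n, \<psi>). optimal_deficiency n \<psi>)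
      \<in> \<Theta>[principal {(n :: nat, \<psi> :: real). 1 < n \<and> 0 < \<psi> \<and> \<psi> < 1
                           \<and> \<kappa> * (1 / \<psi> * ln (1 / \<psi>)) \<le> real n}](
          \<lambda>(n, \<psi>). real n / \<psi> * ln (1 / \<psi>))"
    by (intro bigthetaI'[of "min (\<kappa> / 3) (1 / 2) / 8" 9], simp, simp, unfold eventually_principal)
       (use optimal_deficiency_le optimal_deficiency_ge nonneg nonneg' in \<open>fastforce simp only:
          real_norm_def abs_of_nonneg mem_Collect_eq split_beta\<close>)
qed

end
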